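(* Let $r\in(0,\infty)$, let $I=[a,b]$ with $a<b$, and let $\Phi:[0,\ell(I)]\to\mathbb{R}_+$ be a function such that $\Phi^r$ is superadditive. Then every $\Phi$-Hölder function $f:I\to\mathbb{R}$ is a function of $r$-bounded variation.
   Context: $\mathbb{R}_+=[0,\infty)$, $\ell(I)=b-a$, and $\Phi^r(u)=(\Phi(u))^r$. $\Phi^r$ is superadditive if $\Phi^r(u)+\Phi^r(v)\le\Phi^r(u+v)$ for all $u,v\ge0$ with $u+v\le\ell(I)$. $f$ is $\Phi$-Hölder if $|f(x)-f(y)|\le\Phi(|y-x|)$ for all $x,y\in I$. $f$ is of $r$-bounded variation if the sums $\sum_{i=1}^n|f(x_i)-f(x_{i-1})|^r$ are bounded over all partitions $a=x_0<\cdots<x_n=b$ of $I$. *)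

theory Defs
  imports Complex_Main
begin

text \<open>
  Functions on a compact interval are represented by total functions on the reals; all
  conditions constrain their values on the relevant interval only. Powers with
  exponent \<open>r > 0\<close> are taken with \<open>powr\<close>, for which \<open>0 powr r = 0\<close>.
\<close>

definition superadditive_upto :: "real \<Rightarrow> (real \<Rightarrow> real) \<Rightarrow> bool" where
  "superadditive_upto L \<Psi> \<longleftrightarrow>
     (\<forall>u v. 0 \<le> u \<longrightarrow> 0 \<le> v \<longrightarrow> u + v \<le> L \<longrightarrow> \<Psi> u + \<Psi> v \<le> \<Psi> (u + v))"

definition holder_wrt :: "real set \<Rightarrow> (real \<Rightarrow> real) \<Rightarrow> (real \<Rightarrow> real) \<Rightarrow> bool" where
  "holder_wrt I \<Phi> f \<longleftrightarrow> (\<forall>x\<in>I. \<forall>y\<in>I. \<bar>f x - f y\<bar> \<le> \<Phi> \<bar>y - x\<bar>)"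

text \<open>The points of a partition are \<open>x 0, \<dots>, x n\<close>; later values of \<open>x\<close> are irrelevant.\<close>

definition interval_partition :: "real \<Rightarrow> real \<Rightarrow> nat \<Rightarrow> (nat \<Rightarrow> real) \<Rightarrow> bool" where
  "interval_partition a b n x \<longleftrightarrow> x 0 = a \<and> x n = b \<and> (\<forall>i<n. x i < x (Suc i))"

definition r_bounded_variation :: "real \<Rightarrow> real \<Rightarrow> real \<Rightarrow> (real \<Rightarrow> real) \<Rightarrow> bool" where
  "r_bounded_variation r a b f \<longleftrightarrow>
     (\<exists>C. \<forall>n x. interval_partition a b n x \<longrightarrow>
        (\<Sum>i=1..n. \<bar>f (x i) - f (x (i - 1))\<bar> powr r) \<le> C)"

end

theory Submission
  imports Defs
begin

text \<open>The variation sums have a bound independent of the partition, namely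
  \<open>\<Phi> (b - a) powr r\<close>. The Holder condition bounds each term by
  \<open>\<Phi> powr r\<close> of the corresponding gap; the gaps add up to b - a, so
  superadditivity merges these values into a single one at b - a. The merging is
  \<open>superadditive_sum_le\<close>.\<close>

lemma stepwise_mono:
  fixes x :: "nat \<Rightarrow> 'a::preorder"
  assumes "\<And>i. i < n \<Longrightarrow> x i \<le> x (Suc i)" and "i \<le> j" and "j \<le> n"
  shows "x i \<le> x j"
  using assms(2,3)
proof (induction j rule: dec_induct)
  case (step j)
  then show ?case using assms(1)[of j] by (auto intro: order_trans)
qed simp

text \<open>Superadditivity absorbs the gaps one at a time, by induction on \<open>n\<close>. The
  assumption \<open>0 \<le> \<Psi> 0\<close> settles the empty sum.\<close>

lemma superadditive_sum_le:
  fixes x :: "nat \<Rightarrow> real"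
  assumes "superadditive_upto L \<Psi>" and "0 \<le> \<Psi> 0"
    and "\<And>i. i < n \<Longrightarrow> x i \<le> x (Suc i)" and "x n - x 0 \<le> L"
  shows "(\<Sum>i=1..n. \<Psi> (x i - x (i - 1))) \<le> \<Psi> (x n - x 0)"
  using assms(3,4)
proof (induction n)
  case 0
  then show ?case using assms(2) by simp
next
  case (Suc n)
  have step: "x n \<le> x (Suc n)" using Suc.prems(1) by simp
  \<comment> \<open>Superadditivity applies only to nonnegative lengths of total at most
    \<open>L\<close>; here the total is \<open>x (Suc n) - x 0\<close>.\<close>
  have mono: "x 0 \<le> x n" by (rule stepwise_mono[of "Suc n" x]) (use Suc.prems in auto)
  have "(\<Sum>i=1..n. \<Psi> (x i - x (i - 1))) \<le> \<Psi> (x n - x 0)"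
  proof (rule Suc.IH)
    show "x n - x 0 \<le> L" using step Suc.prems(2) by linarith
  qed (simp add: Suc.prems(1))
  moreover have "\<Psi> (x n - x 0) + \<Psi> (x (Suc n) - x n)
      \<le> \<Psi> ((x n - x 0) + (x (Suc n) - x n))"
    using step mono Suc.prems(2)
    by (intro assms(1)[unfolded superadditive_upto_def, rule_format]) auto
  ultimately show ?case by simp
qed

theorem proposition3p8:
  fixes r a b :: real and \<Phi> :: "real \<Rightarrow> real"
  assumes "0 < r" and "a < b"
    and "\<forall>u\<in>{0..b - a}. 0 \<le> \<Phi> u"
    and "superadditive_upto (b - a) (\<lambda>u. \<Phi> u powr r)"
  shows "\<forall>f :: real \<Rightarrow> real. holder_wrt {a..b} \<Phi> f \<longrightarrow> r_bounded_variation r a b f"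
proof (intro allI impI)
  fix f :: "real \<Rightarrow> real"
  assume f: "holder_wrt {a..b} \<Phi> f"
  have "(\<Sum>i=1..n. \<bar>f (x i) - f (x (i - 1))\<bar> powr r) \<le> \<Phi> (b - a) powr r"
    if "interval_partition a b n x" for n x
  proof -
    from that have ends: "x 0 = a" "x n = b" and step: "\<And>i. i < n \<Longrightarrow> x i \<le> x (Suc i)"
      by (auto simp: interval_partition_def less_imp_le)
    note mono = stepwise_mono[of n x, OF step]
    have "\<bar>f (x i) - f (x (i - 1))\<bar> powr r \<le> \<Phi> (x i - x (i - 1)) powr r"
      if "i \<in> {1..n}" for i
    proof (rule powr_mono2)
      \<comment> \<open>The Holder condition holds only inside the interval; the order of the two
        points turns its absolute distance into the gap. Since \<open>i \<ge> 1\<close>, the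
        subtraction \<open>i - 1\<close> does not truncate.\<close>
      have "x i \<in> {a..b}" "x (i - 1) \<in> {a..b}" "x (i - 1) \<le> x i"
        using that mono[of 0 i] mono[of i n] mono[of 0 "i - 1"] mono[of "i - 1" n]
          mono[of "i - 1" i] ends by auto
      then show "\<bar>f (x i) - f (x (i - 1))\<bar> \<le> \<Phi> (x i - x (i - 1))"
        using f unfolding holder_wrt_def by (metis abs_minus_commute abs_of_nonneg diff_ge_0_iff_ge)
    qed (use assms(1) in auto)
    then have "(\<Sum>i=1..n. \<bar>f (x i) - f (x (i - 1))\<bar> powr r)
        \<le> (\<Sum>i=1..n. \<Phi> (x i - x (i - 1)) powr r)"
      by (rule sum_mono)
    \<comment> \<open>Values of \<open>powr\<close> are nonnegative, which gives the condition at 0;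
      the total length is exactly b - a.\<close>
    also have "\<dots> \<le> \<Phi> (x n - x 0) powr r"
      using superadditive_sum_le[OF assms(4), of n x] step ends by simp
    finally show ?thesis using ends by simp
  qed
  then show "r_bounded_variation r a b f"
    unfolding r_bounded_variation_def by blast
qed

end
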